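(* The finite-level homotopy arrows form a subcategory of $\mathrm{Ho(Gph)}$ (containing all the objects): identities are finite-level homotopy arrows, and the composite of two finite-level homotopy arrows is a finite-level homotopy arrow.
   Context: A graph is $X=(X_0,X_1,s,t)$ with a set $X_0$ of nodes, a set $X_1$ of arcs, and functions $s,t:X_1\to X_0$; loops, multiple arcs and infinite graphs are allowed. Graph morphisms are pairs of functions on nodes and arcs commuting with $s$ and $t$; $[X,Y]$ is the set of graph morphisms $X\to Y$ and $\mathrm{Gph}$ is the category of graphs. $\mathbf{N}$ is the graph with nodes the natural numbers and arcs $(n,n+1)$ from $n$ to $n+1$; $\mathbf{P}_n$ is the path with $n$ arcs (nodes $0,\dots,n$ and arcs $(k,k+1)$). A walk in $X$ is a graph morphism $\mathbf{N}\to X$, and a path of length $n$ in $X$ is a graph morphism $\mathbf{P}_n\to X$. For a walk $\omega$, $\tau(\omega)$ is the walk obtained by deleting its first arc. The walk graph $W(X)$ has the walks in $X$ both as nodes and as arcs, with $s(\omega)=\omega$ and $t(\omega)=\tau(\omega)$; for $f:X\to Y$, $W(f)(\omega)=f\circ\omega$. For $n\ge 0$, the $n$-fold arc graph $A^n(X)$ has as nodes the paths of length $n$ in $X$ and as arcs the paths of length $n+1$; the source of an arc is its initial subpath of length $n$ and the target its final subpath of length $n$ (so $A^0(X)=X$). The source truncation $s_n:W(X)\to A^n(X)$ sends a walk, as node, to its initial path of length $n$ and, as arc, to its initial path of length $n+1$; so $s_0:W(X)\to X$. $\mathrm{Ho(Gph)}$ is the homotopy category inverting the N-equivalences (graph morphisms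 inducing bijections on sets of walks). It is described as follows: its objects are the graphs, the set of homotopy arrows from $X$ to $Y$ is $\mathrm{Ho}(X,Y)=[W(X),Y]$, the identity of $X$ is $s_0:W(X)\to X$, and the composite of $f:W(X)\to Y$ and $g:W(Y)\to Z$ is $g\odot f=g\circ W(f)\circ s_0^{-1}$, where $s_0:W(W(X))\to W(X)$ is a graph isomorphism. A homotopy arrow in $\mathrm{Ho}(X,Y)=[W(X),Y]$ is of level $n$ if it equals $\gamma_n(f)=f\circ s_n$ for some graph morphism $f:A^n(X)\to Y$. A finite-level homotopy arrow is a homotopy arrow of level $n$ for some $n\ge 0$. *)

theory Defs
  imports "Graph_Theory.Digraph" "HOL-Library.FuncSet"
begin

section \<open>Categories and subcategories\<close>

record ('o, 'm) precategory =
  Obj :: "'o set"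
  Hom :: "'o \<Rightarrow> 'o \<Rightarrow> 'm set"
  Ident :: "'o \<Rightarrow> 'm"
  Comp :: "'o \<Rightarrow> 'o \<Rightarrow> 'o \<Rightarrow> 'm \<Rightarrow> 'm \<Rightarrow> 'm"

text \<open>In \<open>Comp C X Y Z g f\<close>, the arrow \<open>f\<close> goes from \<open>X\<close> to \<open>Y\<close> and \<open>g\<close> from \<open>Y\<close> to \<open>Z\<close>.
  Hom-sets of different pairs of objects need not be disjoint.\<close>

locale category =
  fixes C :: "('o, 'm) precategory"
  assumes Ident_in_Hom: "X \<in> Obj C \<Longrightarrow> Ident C X \<in> Hom C X X"
    and Comp_in_Hom: "\<lbrakk>X \<in> Obj C; Y \<in> Obj C; Z \<in> Obj C; f \<in> Hom C X Y; g \<in> Hom C Y Z\<rbrakk>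
      \<Longrightarrow> Comp C X Y Z g f \<in> Hom C X Z"
    and Comp_Ident_right: "\<lbrakk>X \<in> Obj C; Y \<in> Obj C; f \<in> Hom C X Y\<rbrakk>
      \<Longrightarrow> Comp C X X Y f (Ident C X) = f"
    and Comp_Ident_left: "\<lbrakk>X \<in> Obj C; Y \<in> Obj C; f \<in> Hom C X Y\<rbrakk>
      \<Longrightarrow> Comp C X Y Y (Ident C Y) f = f"
    and Comp_assoc: "\<lbrakk>X \<in> Obj C; Y \<in> Obj C; Z \<in> Obj C; V \<in> Obj C;
        f \<in> Hom C X Y; g \<in> Hom C Y Z; h \<in> Hom C Z V\<rbrakk>
      \<Longrightarrow> Comp C X Z V h (Comp C X Y Z g f) = Comp C X Y V (Comp C Y Z V h g) f"

locale subcategory = category C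
  for C :: "('o, 'm) precategory" +
  fixes SObj :: "'o set" and SHom :: "'o \<Rightarrow> 'o \<Rightarrow> 'm set"
  assumes SObj_subset: "SObj \<subseteq> Obj C"
    and SHom_subset: "\<lbrakk>X \<in> SObj; Y \<in> SObj\<rbrakk> \<Longrightarrow> SHom X Y \<subseteq> Hom C X Y"
    and Ident_in_SHom: "X \<in> SObj \<Longrightarrow> Ident C X \<in> SHom X X"
    and Comp_in_SHom: "\<lbrakk>X \<in> SObj; Y \<in> SObj; Z \<in> SObj; f \<in> SHom X Y; g \<in> SHom Y Z\<rbrakk>
      \<Longrightarrow> Comp C X Y Z g f \<in> SHom X Z"


section \<open>Graph morphisms\<close>

text \<open>A graph is a \<open>pre_digraph\<close> satisfying \<open>wf_digraph\<close>, with \<open>s\<close> = \<open>tail\<close> and \<open>t\<close> = \<open>head\<close>.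
  The two components of a graph morphism are extensional functions (\<open>undefined\<close> outside
  the nodes, respectively arcs, of the domain), so that HOL equality is equality of morphisms.\<close>

type_synonym ('v, 'e, 'w, 'd) gph_mor = "('v \<Rightarrow> 'w) \<times> ('e \<Rightarrow> 'd)"

definition gph_hom ::
  "('v, 'e) pre_digraph \<Rightarrow> ('w, 'd) pre_digraph \<Rightarrow> ('v, 'e, 'w, 'd) gph_mor set" where
  "gph_hom X Y = {(f0, f1).
     f0 \<in> verts X \<rightarrow>\<^sub>E verts Y \<and> f1 \<in> arcs X \<rightarrow>\<^sub>E arcs Y \<and>
     (\<forall>a\<in>arcs X. tail Y (f1 a) = f0 (tail X a) \<and> head Y (f1 a) = f0 (head X a))}"

definition gph_id :: "('v, 'e) pre_digraph \<Rightarrow> ('v, 'e, 'v, 'e) gph_mor" where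
  "gph_id X = ((\<lambda>v\<in>verts X. v), (\<lambda>a\<in>arcs X. a))"

text \<open>\<open>gph_comp X g f\<close> is the composite of \<open>f\<close> with domain \<open>X\<close>, followed by \<open>g\<close>.\<close>

definition gph_comp ::
  "('v, 'e) pre_digraph \<Rightarrow> ('w, 'd, 'u, 'c) gph_mor \<Rightarrow> ('v, 'e, 'w, 'd) gph_mor
    \<Rightarrow> ('v, 'e, 'u, 'c) gph_mor" where
  "gph_comp X g f = (compose (verts X) (fst g) (fst f), compose (arcs X) (snd g) (snd f))"

definition gph_inv ::
  "('v, 'e) pre_digraph \<Rightarrow> ('w, 'd) pre_digraph \<Rightarrow> ('v, 'e, 'w, 'd) gph_mor
    \<Rightarrow> ('w, 'd, 'v, 'e) gph_mor" where
  "gph_inv X Y f = (THE g. g \<in> gph_hom Y X \<and>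
     gph_comp X g f = gph_id X \<and> gph_comp Y f g = gph_id Y)"


section \<open>Walks and paths\<close>

definition N_gph :: "(nat, nat \<times> nat) pre_digraph" where
  "N_gph = \<lparr>verts = UNIV, arcs = {(k, Suc k) | k. True}, tail = fst, head = snd\<rparr>"

definition P_gph :: "nat \<Rightarrow> (nat, nat \<times> nat) pre_digraph" where
  "P_gph n = \<lparr>verts = {..n}, arcs = {(k, Suc k) | k. k < n}, tail = fst, head = snd\<rparr>"

text \<open>Walks and paths both have this type; extensionality tells them and their lengths apart.\<close>

type_synonym ('v, 'e) walk = "(nat, nat \<times> nat, 'v, 'e) gph_mor"

definition walks :: "('v, 'e) pre_digraph \<Rightarrow> ('v, 'e) walk set" where
  "walks X = gph_hom N_gph X"

definition paths :: "nat \<Rightarrow> ('v, 'e) pre_digraph \<Rightarrow> ('v, 'e) walk set" where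
  "paths n X = gph_hom (P_gph n) X"

definition shift :: "(nat, nat \<times> nat) pre_digraph \<Rightarrow> (nat, nat \<times> nat, nat, nat \<times> nat) gph_mor" where
  "shift G = ((\<lambda>k\<in>verts G. Suc k), (\<lambda>a\<in>arcs G. (Suc (fst a), Suc (snd a))))"

definition walk_tl :: "('v, 'e) walk \<Rightarrow> ('v, 'e) walk" where
  "walk_tl \<omega> = gph_comp N_gph \<omega> (shift N_gph)"

text \<open>The following two are precomposition with the inclusion of \<open>P_gph n\<close> as the first \<open>n\<close> arcs
  of a longer path or of \<open>N_gph\<close>, and with the inclusion of \<open>P_gph n\<close> as the last \<open>n\<close> arcs
  of \<open>P_gph (Suc n)\<close>.\<close>

definition initial_path :: "nat \<Rightarrow> ('v, 'e) walk \<Rightarrow> ('v, 'e) walk" where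
  "initial_path n \<pi> = gph_comp (P_gph n) \<pi> (gph_id (P_gph n))"

definition final_path :: "nat \<Rightarrow> ('v, 'e) walk \<Rightarrow> ('v, 'e) walk" where
  "final_path n \<pi> = gph_comp (P_gph n) \<pi> (shift (P_gph n))"


section \<open>The walk graph and the iterated arc graphs\<close>

definition W :: "('v, 'e) pre_digraph \<Rightarrow> (('v, 'e) walk, ('v, 'e) walk) pre_digraph" where
  "W X = \<lparr>verts = walks X, arcs = walks X, tail = (\<lambda>\<omega>. \<omega>), head = walk_tl\<rparr>"

definition W_map ::
  "('v, 'e) pre_digraph \<Rightarrow> ('v, 'e, 'w, 'd) gph_mor
    \<Rightarrow> (('v, 'e) walk, ('v, 'e) walk, ('w, 'd) walk, ('w, 'd) walk) gph_mor" where
  "W_map X f = ((\<lambda>\<omega>\<in>walks X. gph_comp N_gph f \<omega>), (\<lambda>\<omega>\<in>walks X. gph_comp N_gph f \<omega>))"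

definition arc_gph :: "nat \<Rightarrow> ('v, 'e) pre_digraph \<Rightarrow> (('v, 'e) walk, ('v, 'e) walk) pre_digraph" where
  "arc_gph n X = \<lparr>verts = paths n X, arcs = paths (Suc n) X,
     tail = initial_path n, head = final_path n\<rparr>"

definition source_trunc ::
  "nat \<Rightarrow> ('v, 'e) pre_digraph
    \<Rightarrow> (('v, 'e) walk, ('v, 'e) walk, ('v, 'e) walk, ('v, 'e) walk) gph_mor" where
  "source_trunc n X = ((\<lambda>\<omega>\<in>walks X. initial_path n \<omega>), (\<lambda>\<omega>\<in>walks X. initial_path (Suc n) \<omega>))"

text \<open>The map \<open>s\<^sub>0\<close> with values in \<open>X\<close> itself: \<open>source_trunc 0 X\<close> followed by the canonical
  isomorphism from \<open>arc_gph 0 X\<close> to \<open>X\<close>, usually written as an equality.\<close>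

definition s0 :: "('v, 'e) pre_digraph \<Rightarrow> (('v, 'e) walk, ('v, 'e) walk, 'v, 'e) gph_mor" where
  "s0 X = ((\<lambda>\<omega>\<in>walks X. fst \<omega> 0), (\<lambda>\<omega>\<in>walks X. snd \<omega> (0, 1)))"


section \<open>The homotopy category and finite-level arrows\<close>

type_synonym ('v, 'e, 'w, 'd) ho_arrow = "(('v, 'e) walk, ('v, 'e) walk, 'w, 'd) gph_mor"

definition Ho ::
  "('v, 'e) pre_digraph \<Rightarrow> ('w, 'd) pre_digraph \<Rightarrow> ('v, 'e, 'w, 'd) ho_arrow set" where
  "Ho X Y = gph_hom (W X) Y"

text \<open>\<open>g \<circ> W(f) \<circ> s\<^sub>0\<^sup>-\<^sup>1\<close>, for \<open>f\<close> in \<open>Ho X Y\<close> and \<open>g\<close> in \<open>Ho Y Z\<close>; here \<open>s0 (W X)\<close> maps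
  \<open>W (W X)\<close> to \<open>W X\<close>.\<close>

definition ho_comp ::
  "('v, 'e) pre_digraph \<Rightarrow> ('w, 'd, 'u, 'c) ho_arrow \<Rightarrow> ('v, 'e, 'w, 'd) ho_arrow
    \<Rightarrow> ('v, 'e, 'u, 'c) ho_arrow" where
  "ho_comp X g f = gph_comp (W X) g
     (gph_comp (W X) (W_map (W X) f) (gph_inv (W (W X)) (W X) (s0 (W X))))"

text \<open>The objects are all graphs with nodes of type \<open>'v\<close> and arcs of type \<open>'e\<close>.\<close>

definition HoGph :: "(('v, 'e) pre_digraph, ('v, 'e, 'v, 'e) ho_arrow) precategory" where
  "HoGph = \<lparr>Obj = {X. wf_digraph X}, Hom = Ho, Ident = s0, Comp = (\<lambda>X Y Z. ho_comp X)\<rparr>"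

definition ho_gamma ::
  "nat \<Rightarrow> ('v, 'e) pre_digraph \<Rightarrow> (('v, 'e) walk, ('v, 'e) walk, 'w, 'd) gph_mor
    \<Rightarrow> ('v, 'e, 'w, 'd) ho_arrow" where
  "ho_gamma n X f = gph_comp (W X) f (source_trunc n X)"

definition of_level ::
  "nat \<Rightarrow> ('v, 'e) pre_digraph \<Rightarrow> ('w, 'd) pre_digraph \<Rightarrow> ('v, 'e, 'w, 'd) ho_arrow \<Rightarrow> bool" where
  "of_level n X Y h \<longleftrightarrow> h \<in> Ho X Y \<and> (\<exists>f\<in>gph_hom (arc_gph n X) Y. h = ho_gamma n X f)"

definition finite_level ::
  "('v, 'e) pre_digraph \<Rightarrow> ('w, 'd) pre_digraph \<Rightarrow> ('v, 'e, 'w, 'd) ho_arrow set" where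
  "finite_level X Y = {h. \<exists>n. of_level n X Y h}"

end

(* A homotopy arrow f : W(X) -> Y amounts to the map "walk_ext f" from walks in X to walks in Y
   that commutes with the deletion of the first arc, and composition of homotopy arrows becomes
   composition of such maps.  If f has level n, then the first m arcs of "walk_ext f w" depend only
   on the first m + n arcs of w, through a function defined on all paths of length m + n.
   So an arrow of level n followed by an arrow of level m has level m + n. *)
theory Submission
  imports Defs
begin

section \<open>Graph morphisms, walks and paths\<close>

lemma gph_homD:
  assumes "f \<in> gph_hom X Y"
  shows "v \<in> verts X \<Longrightarrow> fst f v \<in> verts Y"
    and "a \<in> arcs X \<Longrightarrow> snd f a \<in> arcs Y"
    and "a \<in> arcs X \<Longrightarrow> tail Y (snd f a) = fst f (tail X a)"
    and "a \<in> arcs X \<Longrightarrow> head Y (snd f a) = fst f (head X a)"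
    and "fst f \<in> extensional (verts X)"
    and "snd f \<in> extensional (arcs X)"
  using assms by (auto simp: gph_hom_def PiE_def split: prod.splits)

lemma gph_homI:
  assumes "\<And>v. v \<in> verts X \<Longrightarrow> fst f v \<in> verts Y"
    and "\<And>a. a \<in> arcs X \<Longrightarrow> snd f a \<in> arcs Y"
    and "\<And>a. a \<in> arcs X \<Longrightarrow> tail Y (snd f a) = fst f (tail X a)"
    and "\<And>a. a \<in> arcs X \<Longrightarrow> head Y (snd f a) = fst f (head X a)"
    and "fst f \<in> extensional (verts X)"
    and "snd f \<in> extensional (arcs X)"
  shows "f \<in> gph_hom X Y"
  using assms by (auto simp: gph_hom_def PiE_def split: prod.splits)

text \<open>Two-sided inverses are unique, since g' y = g' (f (g y)) = g y on \<open>Y\<close>, so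
  any explicit inverse is the value of the \<open>THE\<close>. Extensionality settles the values
  elsewhere.\<close>

lemma gph_inv_eqI:
  assumes "f \<in> gph_hom X Y" and g: "g \<in> gph_hom Y X"
    and gf: "gph_comp X g f = gph_id X" and fg: "gph_comp Y f g = gph_id Y"
  shows "gph_inv X Y f = g"
  unfolding gph_inv_def
proof (rule the_equality)
  fix g' assume g': "g' \<in> gph_hom Y X \<and> gph_comp X g' f = gph_id X \<and> gph_comp Y f g' = gph_id Y"
  then have g'_hom: "g' \<in> gph_hom Y X" and g'f: "gph_comp X g' f = gph_id X"
    by auto
  have "fst g' y = fst g y" if y: "y \<in> verts Y" for y
  proof -
    have "fst f (fst g y) = y"
      using fun_cong[OF arg_cong[OF fg, of fst], of y] y by (simp add: gph_comp_def gph_id_def compose_def)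
    moreover have "fst g' (fst f (fst g y)) = fst g y"
      using fun_cong[OF arg_cong[OF g'f, of fst], of "fst g y"] gph_homD(1)[OF g y]
      by (simp add: gph_comp_def gph_id_def compose_def)
    ultimately show ?thesis by simp
  qed
  moreover have "snd g' y = snd g y" if y: "y \<in> arcs Y" for y
  proof -
    have "snd f (snd g y) = y"
      using fun_cong[OF arg_cong[OF fg, of snd], of y] y by (simp add: gph_comp_def gph_id_def compose_def)
    moreover have "snd g' (snd f (snd g y)) = snd g y"
      using fun_cong[OF arg_cong[OF g'f, of snd], of "snd g y"] gph_homD(2)[OF g y]
      by (simp add: gph_comp_def gph_id_def compose_def)
    ultimately show ?thesis by simp
  qed
  ultimately show "g' = g"
    by (intro prod_eqI extensionalityI[OF gph_homD(5)[OF g'_hom] gph_homD(5)[OF g]]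
        extensionalityI[OF gph_homD(6)[OF g'_hom] gph_homD(6)[OF g]])
qed (use g gf fg in auto)

section \<open>Walks, paths and their segments\<close>

lemma walks_iff:
  "\<omega> \<in> walks X \<longleftrightarrow> (\<forall>k. fst \<omega> k \<in> verts X) \<and> snd \<omega> \<in> extensional {(k, Suc k) |k. True} \<and>
    (\<forall>k. snd \<omega> (k, Suc k) \<in> arcs X \<and> tail X (snd \<omega> (k, Suc k)) = fst \<omega> k \<and>
      head X (snd \<omega> (k, Suc k)) = fst \<omega> (Suc k))"
  by (auto simp: walks_def gph_hom_def N_gph_def PiE_def split: prod.splits)

lemma paths_iff:
  "\<pi> \<in> paths n X \<longleftrightarrow> fst \<pi> \<in> extensional {..n} \<and> (\<forall>k\<le>n. fst \<pi> k \<in> verts X) \<and>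
    snd \<pi> \<in> extensional {(k, Suc k) |k. k < n} \<and>
    (\<forall>k<n. snd \<pi> (k, Suc k) \<in> arcs X \<and> tail X (snd \<pi> (k, Suc k)) = fst \<pi> k \<and>
      head X (snd \<pi> (k, Suc k)) = fst \<pi> (Suc k))"
  by (auto simp: paths_def gph_hom_def P_gph_def PiE_def split: prod.splits)

lemma walk_eqI:
  assumes "\<omega> \<in> walks X" "\<omega>' \<in> walks Y"
    and "\<And>k. fst \<omega> k = fst \<omega>' k" "\<And>k. snd \<omega> (k, Suc k) = snd \<omega>' (k, Suc k)"
  shows "\<omega> = \<omega>'"
proof (rule prod_eqI)
  show "snd \<omega> = snd \<omega>'"
    by (rule extensionalityI[of _ "{(k, Suc k) |k. True}"]) (use assms in \<open>auto simp: walks_iff\<close>)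
qed (use assms in auto)

text \<open>Common form of \<open>initial_path\<close> (\<open>k = 0\<close>) and
  \<open>final_path\<close> (\<open>k = 1\<close>), for walks as well as paths. Indices restart at
  0, so nested segments combine by adding offsets.\<close>

definition segment :: "nat \<Rightarrow> nat \<Rightarrow> ('v, 'e) walk \<Rightarrow> ('v, 'e) walk" where
  "segment k n \<pi> = ((\<lambda>i\<in>{..n}. fst \<pi> (k + i)),
     (\<lambda>a\<in>{(i, Suc i) |i. i < n}. snd \<pi> (k + fst a, k + snd a)))"

lemma initial_path_eq_segment: "initial_path n \<pi> = segment 0 n \<pi>"
  by (auto simp: initial_path_def segment_def gph_comp_def gph_id_def P_gph_def compose_def
      restrict_def fun_eq_iff)

lemma final_path_eq_segment: "final_path n \<pi> = segment (Suc 0) n \<pi>"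
  by (auto simp: final_path_def segment_def gph_comp_def shift_def P_gph_def compose_def
      restrict_def fun_eq_iff)

lemma segment_segment: "i + n' \<le> n \<Longrightarrow> segment i n' (segment k n \<pi>) = segment (k + i) n' \<pi>"
  by (auto simp: segment_def restrict_def fun_eq_iff add.assoc)

lemma segment_in_paths: "\<pi> \<in> paths l X \<Longrightarrow> k + n \<le> l \<Longrightarrow> segment k n \<pi> \<in> paths n X"
  by (auto simp: paths_iff segment_def)

lemma segment_walk_in_paths: "\<omega> \<in> walks X \<Longrightarrow> segment k n \<omega> \<in> paths n X"
  by (auto simp: paths_iff walks_iff segment_def)

lemma walk_tl_simps [simp]:
  "fst (walk_tl \<omega>) k = fst \<omega> (Suc k)"
  "snd (walk_tl \<omega>) (k, Suc k) = snd \<omega> (Suc k, Suc (Suc k))"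
  by (auto simp: walk_tl_def gph_comp_def shift_def N_gph_def compose_def)

lemma walk_tl_in_walks [simp]: "\<omega> \<in> walks X \<Longrightarrow> walk_tl \<omega> \<in> walks X"
proof -
  have "snd (walk_tl \<omega>) \<in> extensional {(k, Suc k) |k. True}"
    by (auto simp: walk_tl_def gph_comp_def N_gph_def compose_def)
  then show "\<omega> \<in> walks X \<Longrightarrow> walk_tl \<omega> \<in> walks X"
    by (simp add: walks_iff)
qed

lemma funpow_walk_tl_in_walks [simp]: "\<omega> \<in> walks X \<Longrightarrow> (walk_tl ^^ k) \<omega> \<in> walks X"
  by (induction k) auto

lemma funpow_walk_tl_simps [simp]:
  "fst ((walk_tl ^^ k) \<omega>) i = fst \<omega> (k + i)"
  "snd ((walk_tl ^^ k) \<omega>) (i, Suc i) = snd \<omega> (k + i, Suc (k + i))"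
  by (induction k arbitrary: i) auto

lemma segment_funpow_walk_tl: "segment i n ((walk_tl ^^ k) \<omega>) = segment (k + i) n \<omega>"
  by (auto simp: segment_def restrict_def fun_eq_iff add.assoc)

section \<open>Composition of homotopy arrows\<close>

lemma W_simps [simp]:
  "verts (W X) = walks X" "arcs (W X) = walks X" "tail (W X) \<omega> = \<omega>" "head (W X) = walk_tl"
  by (auto simp: W_def)

lemma s0_in_Ho: "s0 X \<in> Ho X X"
  unfolding Ho_def by (rule gph_homI) (simp_all add: s0_def, simp_all add: walks_iff)

text \<open>The walk in \<open>W X\<close> starting at \<open>\<omega>\<close>: it is unique, because \<open>\<omega>\<close> is the only arc of \<open>W X\<close>
  with source \<open>\<omega>\<close>.\<close>

definition W_walk :: "('v, 'e) walk \<Rightarrow> (('v, 'e) walk, ('v, 'e) walk) walk" where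
  "W_walk \<omega> = ((\<lambda>k. (walk_tl ^^ k) \<omega>), (\<lambda>a\<in>{(k, Suc k) |k. True}. (walk_tl ^^ fst a) \<omega>))"

lemma W_walk_in_walks: "\<omega> \<in> walks X \<Longrightarrow> W_walk \<omega> \<in> walks (W X)"
  by (auto simp: W_walk_def walks_iff[of _ "W X"])

lemma W_walk_walk_tl: "\<omega> \<in> walks X \<Longrightarrow> W_walk (walk_tl \<omega>) = walk_tl (W_walk \<omega>)"
  by (rule walk_eqI[of _ "W X" _ "W X"])
    (auto simp: W_walk_in_walks, auto simp: W_walk_def funpow_swap1)

text \<open>An arc of \<open>W X\<close> is its own source, so arc k of \<open>\<Omega>\<close>
  equals node k; its target is its \<open>walk_tl\<close>, so node k is the k-fold tail of node
  0.\<close>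

lemma walks_W_unique:
  assumes "\<Omega> \<in> walks (W X)"
  shows "W_walk (fst \<Omega> 0) = \<Omega>" "snd \<Omega> (k, Suc k) = fst \<Omega> k"
proof -
  have snd_eq: "snd \<Omega> (k, Suc k) = fst \<Omega> k" for k
    using assms by (simp add: walks_iff[of _ "W X"])
  have "walk_tl (snd \<Omega> (k, Suc k)) = fst \<Omega> (Suc k)" for k
    using assms unfolding walks_iff[of _ "W X"] W_simps by blast
  then have tl: "walk_tl (fst \<Omega> k) = fst \<Omega> (Suc k)" for k
    unfolding snd_eq .
  have "(walk_tl ^^ k) (fst \<Omega> 0) = fst \<Omega> k" for k
    by (induction k) (auto simp: tl)
  moreover have "fst \<Omega> 0 \<in> walks X"
    using assms by (auto simp: walks_iff[of _ "W X"])
  ultimately show "W_walk (fst \<Omega> 0) = \<Omega>"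
    by (intro walk_eqI[of _ "W X" _ "W X"] W_walk_in_walks assms) (auto simp: snd_eq W_walk_def)
  show "snd \<Omega> (k, Suc k) = fst \<Omega> k" by (fact snd_eq)
qed

lemma gph_inv_s0_W:
  "gph_inv (W (W X)) (W X) (s0 (W X)) = ((\<lambda>\<omega>\<in>walks X. W_walk \<omega>), (\<lambda>\<omega>\<in>walks X. W_walk \<omega>))"
proof (rule gph_inv_eqI)
  let ?g = "((\<lambda>\<omega>\<in>walks X. W_walk \<omega>), (\<lambda>\<omega>\<in>walks X. W_walk \<omega>))"
  show "s0 (W X) \<in> gph_hom (W (W X)) (W X)"
    using s0_in_Ho[of "W X"] by (simp add: Ho_def)
  show "?g \<in> gph_hom (W X) (W (W X))"
    by (rule gph_homI) (auto simp: W_walk_in_walks W_walk_walk_tl)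
  have start: "fst \<Omega> 0 \<in> walks X" if "\<Omega> \<in> walks (W X)" for \<Omega>
    using that by (auto simp: walks_iff[of _ "W X"])
  \<comment> \<open>On arcs, \<open>s0 (W X)\<close> returns the first arc of
    \<open>\<Omega>\<close>, which is the node \<open>fst \<Omega> 0\<close>; the same uniqueness
    thus serves both components.\<close>
  show "gph_comp (W (W X)) ?g (s0 (W X)) = gph_id (W (W X))"
    using start walks_W_unique(1)[where X = X] walks_W_unique(2)[where X = X and k = 0]
    unfolding gph_comp_def gph_id_def s0_def
    by (intro arg_cong2[of _ _ _ _ Pair] ext) (simp_all add: compose_def)
  have "fst (W_walk \<omega>) 0 = \<omega>" "snd (W_walk \<omega>) (0, Suc 0) = \<omega>" for \<omega> :: "('a, 'b) walk"
    by (auto simp: W_walk_def)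
  then show "gph_comp (W X) (s0 (W X)) ?g = gph_id (W X)"
    by (auto simp: gph_comp_def gph_id_def s0_def compose_def restrict_def fun_eq_iff W_walk_in_walks)
qed

text \<open>This is \<open>f\<close> composed with \<open>W_walk \<omega>\<close>, hence on walks
  \<open>W_map (W X) f\<close> after the inverse of \<open>s0 (W X)\<close>.\<close>

definition walk_ext :: "('v, 'e, 'w, 'd) ho_arrow \<Rightarrow> ('v, 'e) walk \<Rightarrow> ('w, 'd) walk" where
  "walk_ext f \<omega> = ((\<lambda>k. fst f ((walk_tl ^^ k) \<omega>)),
     (\<lambda>a\<in>{(k, Suc k) |k. True}. snd f ((walk_tl ^^ fst a) \<omega>)))"

lemma walk_ext_simps [simp]:
  "fst (walk_ext f \<omega>) k = fst f ((walk_tl ^^ k) \<omega>)"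
  "snd (walk_ext f \<omega>) (k, Suc k) = snd f ((walk_tl ^^ k) \<omega>)"
  by (auto simp: walk_ext_def)

text \<open>Consecutive arcs fit together: as \<open>f\<close> is a morphism,
  \<open>snd f \<omega>\<close> runs from \<open>fst f \<omega>\<close> to
  \<open>fst f (walk_tl \<omega>)\<close>.\<close>

lemma walk_ext_in_walks:
  assumes f: "f \<in> Ho X Y" and "\<omega> \<in> walks X"
  shows "walk_ext f \<omega> \<in> walks Y"
proof -
  have "(walk_tl ^^ k) \<omega> \<in> walks X" for k using assms by simp
  then show ?thesis
    using gph_homD[OF f[unfolded Ho_def]] by (simp add: walks_iff[of _ Y]) (simp add: walk_ext_def)
qed

lemma walk_ext_walk_tl:
  assumes "f \<in> Ho X Y" and "\<omega> \<in> walks X"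
  shows "walk_ext f (walk_tl \<omega>) = walk_tl (walk_ext f \<omega>)"
  by (rule walk_eqI[of _ Y _ Y]) (use assms in \<open>auto simp: walk_ext_in_walks funpow_swap1\<close>)

lemma walk_ext_funpow_walk_tl:
  assumes "f \<in> Ho X Y" and "\<omega> \<in> walks X"
  shows "walk_ext f ((walk_tl ^^ k) \<omega>) = (walk_tl ^^ k) (walk_ext f \<omega>)"
  by (induction k) (use assms in \<open>auto simp: walk_ext_walk_tl\<close>)

text \<open>With the inverse of \<open>s0 (W X)\<close> made explicit, composition needs no
  \<open>THE\<close>; all later arguments start from this formula.\<close>

lemma ho_comp_eq:
  "ho_comp X g f =
    ((\<lambda>\<omega>\<in>walks X. fst g (walk_ext f \<omega>)), (\<lambda>\<omega>\<in>walks X. snd g (walk_ext f \<omega>)))"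
proof -
  have "gph_comp N_gph f (W_walk \<omega>) = walk_ext f \<omega>" for \<omega>
    by (auto simp: gph_comp_def N_gph_def compose_def W_walk_def walk_ext_def restrict_def fun_eq_iff)
  then show ?thesis
    by (auto simp: ho_comp_def gph_inv_s0_W gph_comp_def W_map_def compose_def restrict_def
        fun_eq_iff W_walk_in_walks)
qed

lemma ho_comp_in_Ho:
  assumes f: "f \<in> Ho X Y" and g: "g \<in> Ho Y Z"
  shows "ho_comp X g f \<in> Ho X Z"
  unfolding Ho_def
  by (rule gph_homI)
    (use gph_homD[OF g[unfolded Ho_def]] f in
      \<open>auto simp: ho_comp_eq walk_ext_in_walks walk_ext_walk_tl\<close>)

section \<open>The category laws\<close>

lemma ho_arrow_eqI:
  assumes "f \<in> Ho X Y" "g \<in> Ho X Y"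
    and "\<And>\<omega>. \<omega> \<in> walks X \<Longrightarrow> fst f \<omega> = fst g \<omega>" "\<And>\<omega>. \<omega> \<in> walks X \<Longrightarrow> snd f \<omega> = snd g \<omega>"
  shows "f = g"
  using assms gph_homD(5,6)[of _ "W X" Y] unfolding Ho_def W_simps
  by (intro prod_eqI) (metis extensionalityI)+

lemma walk_ext_s0: "\<omega> \<in> walks X \<Longrightarrow> walk_ext (s0 X) \<omega> = \<omega>"
  by (rule walk_eqI[of _ X _ X]) (auto simp: walk_ext_in_walks[OF s0_in_Ho], auto simp: s0_def)

lemma ho_comp_s0_right: "f \<in> Ho X Y \<Longrightarrow> ho_comp X f (s0 X) = f"
  by (rule ho_arrow_eqI[of _ X Y])
    (auto simp: ho_comp_in_Ho[OF s0_in_Ho], auto simp: ho_comp_eq walk_ext_s0)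

lemma ho_comp_s0_left:
  assumes "f \<in> Ho X Y"
  shows "ho_comp X (s0 Y) f = f"
proof (rule ho_arrow_eqI[of _ X Y])
  fix \<omega> assume "\<omega> \<in> walks X"
  \<comment> \<open>\<open>s0 Y\<close> reads node 0 and the first arc of
    \<open>walk_ext f \<omega>\<close>, which are the values of \<open>f\<close> at
    \<open>\<omega>\<close> itself.\<close>
  then show "fst (ho_comp X (s0 Y) f) \<omega> = fst f \<omega>" "snd (ho_comp X (s0 Y) f) \<omega> = snd f \<omega>"
    using assms walk_ext_simps[of f \<omega> 0] by (auto simp: ho_comp_eq s0_def walk_ext_in_walks)
qed (auto simp: assms ho_comp_in_Ho[OF _ s0_in_Ho])

text \<open>Entry k on the left uses \<open>walk_ext f\<close> of the k-fold tail of
  \<open>\<omega>\<close>, on the right the k-fold tail of \<open>walk_ext f \<omega>\<close>; these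
  agree because \<open>walk_ext f\<close> commutes with \<open>walk_tl\<close>.\<close>

lemma walk_ext_ho_comp:
  assumes "f \<in> Ho X Y" "g \<in> Ho Y Z" "\<omega> \<in> walks X"
  shows "walk_ext (ho_comp X g f) \<omega> = walk_ext g (walk_ext f \<omega>)"
proof (rule walk_eqI[of _ Z _ Z])
  show "walk_ext (ho_comp X g f) \<omega> \<in> walks Z"
    using assms by (blast intro: walk_ext_in_walks ho_comp_in_Ho)
  show "walk_ext g (walk_ext f \<omega>) \<in> walks Z"
    using assms by (blast intro: walk_ext_in_walks)
qed (use assms in \<open>auto simp: ho_comp_eq walk_ext_funpow_walk_tl\<close>)

lemma ho_comp_assoc:
  assumes "f \<in> Ho X Y" "g \<in> Ho Y Z"
  shows "ho_comp X h (ho_comp X g f) = ho_comp X (ho_comp Y h g) f"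
proof -
  \<comment> \<open>Outside \<open>walks Y\<close> the inner composite \<open>ho_comp Y h g\<close>
    is \<open>undefined\<close>.\<close>
  have "walk_ext f \<omega> \<in> walks Y" if "\<omega> \<in> walks X" for \<omega>
    using assms(1) that by (rule walk_ext_in_walks)
  then show ?thesis
    using walk_ext_ho_comp[OF assms]
    unfolding ho_comp_eq[of X h] ho_comp_eq[of X "ho_comp Y h g"]
    by (intro arg_cong2[of _ _ _ _ Pair] restrict_ext) (simp_all add: ho_comp_eq[of Y h])
qed

section \<open>Arrows of finite level\<close>

lemma arc_gph_simps [simp]:
  "verts (arc_gph n X) = paths n X" "arcs (arc_gph n X) = paths (Suc n) X"
  "tail (arc_gph n X) = segment 0 n" "head (arc_gph n X) = segment (Suc 0) n"
  by (auto simp: arc_gph_def initial_path_eq_segment final_path_eq_segment fun_eq_iff)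

lemma ho_gamma_eq:
  "ho_gamma n X f = ((\<lambda>\<omega>\<in>walks X. fst f (segment 0 n \<omega>)),
    (\<lambda>\<omega>\<in>walks X. snd f (segment 0 (Suc n) \<omega>)))"
  by (auto simp: ho_gamma_def gph_comp_def source_trunc_def compose_def initial_path_eq_segment
      restrict_def fun_eq_iff)

lemma s0_finite_level: "s0 X \<in> finite_level X X"
proof -
  \<comment> \<open>The canonical isomorphism from \<open>arc_gph 0 X\<close> to \<open>X\<close>,
    so the identity has level 0.\<close>
  let ?f = "((\<lambda>\<pi>\<in>paths 0 X. fst \<pi> 0), (\<lambda>\<pi>\<in>paths (Suc 0) X. snd \<pi> (0, Suc 0)))"
  have "?f \<in> gph_hom (arc_gph 0 X) X"
    by (rule gph_homI)
      (auto simp: segment_in_paths paths_iff[of _ 0] paths_iff[of _ "Suc 0"] segment_def)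
  moreover have "s0 X = ho_gamma 0 X ?f"
    by (auto simp: ho_gamma_eq s0_def segment_walk_in_paths restrict_def fun_eq_iff)
      (auto simp: segment_def)
  ultimately show ?thesis
    using s0_in_Ho unfolding finite_level_def of_level_def by blast
qed

text \<open>The map \<open>A\<^sup>m(f)\<close> on nodes, under the identification of \<open>A\<^sup>m(A\<^sup>n(X))\<close> with \<open>A\<^sup>m\<^sup>+\<^sup>n(X)\<close>.\<close>

definition path_ext ::
  "nat \<Rightarrow> (('v, 'e) walk, ('v, 'e) walk, 'w, 'd) gph_mor \<Rightarrow> nat \<Rightarrow> ('v, 'e) walk \<Rightarrow> ('w, 'd) walk" where
  "path_ext n f m \<pi> = ((\<lambda>k\<in>{..m}. fst f (segment k n \<pi>)),
     (\<lambda>a\<in>{(k, Suc k) |k. k < m}. snd f (segment (fst a) (Suc n) \<pi>)))"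

text \<open>The last arc uses the segment of length \<open>Suc n\<close> from m - 1, ending at m +
  n, so nothing beyond \<open>\<pi>\<close> is read. The initial and final parts of
  \<open>segment k (Suc n) \<pi>\<close> are the segments giving nodes k and k + 1.\<close>

lemma path_ext_in_paths:
  assumes f: "f \<in> gph_hom (arc_gph n X) Y" and \<pi>: "\<pi> \<in> paths (m + n) X"
  shows "path_ext n f m \<pi> \<in> paths m Y"
  using gph_homD[OF f] segment_in_paths[OF \<pi>]
  by (auto simp: paths_iff[of _ m Y] path_ext_def segment_segment)

lemma segment_path_ext:
  "i + m' \<le> m \<Longrightarrow> segment i m' (path_ext n f m \<pi>) = path_ext n f m' (segment i (m' + n) \<pi>)"
  by (auto simp: segment_def[of i m'] path_ext_def segment_segment restrict_def fun_eq_iff)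

text \<open>Node k of the image depends on \<open>\<omega>\<close> only through
  \<open>segment k n \<omega>\<close>, and arc k through \<open>segment k (Suc n) \<omega>\<close>;
  for the first m arcs these lie within the first m + n arcs of \<open>\<omega>\<close>.\<close>

lemma segment_walk_ext_ho_gamma:
  "\<omega> \<in> walks X \<Longrightarrow>
    segment 0 m (walk_ext (ho_gamma n X f) \<omega>) = path_ext n f m (segment 0 (m + n) \<omega>)"
  by (auto simp: segment_def[of 0 m] path_ext_def segment_segment restrict_def fun_eq_iff)
    (auto simp: ho_gamma_eq segment_funpow_walk_tl)

lemma of_level_ho_comp:
  assumes "of_level n X Y f" "of_level m Y Z g"
  shows "of_level (m + n) X Z (ho_comp X g f)"
proof -
  obtain f' where f: "f \<in> Ho X Y" and f': "f' \<in> gph_hom (arc_gph n X) Y" and f_eq: "f = ho_gamma n X f'"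
    using assms(1) by (auto simp: of_level_def)
  obtain g' where g: "g \<in> Ho Y Z" and g': "g' \<in> gph_hom (arc_gph m Y) Z" and g_eq: "g = ho_gamma m Y g'"
    using assms(2) by (auto simp: of_level_def)
  \<comment> \<open>\<open>g'\<close> after the m-fold arc graph map of \<open>f'\<close>; arcs are
    paths one longer, hence \<open>Suc m\<close>.\<close>
  let ?h = "((\<lambda>\<pi>\<in>paths (m + n) X. fst g' (path_ext n f' m \<pi>)),
    (\<lambda>\<pi>\<in>paths (Suc (m + n)) X. snd g' (path_ext n f' (Suc m) \<pi>)))"
  \<comment> \<open>Here \<open>m\<close> is bound afresh, to allow both \<open>m\<close> for nodes
    and \<open>Suc m\<close> for arcs.\<close>
  have ext: "path_ext n f' m \<pi> \<in> paths m Y" if "\<pi> \<in> paths (m + n) X" for m \<pi>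
    using path_ext_in_paths[OF f' that] .
  have ext_Suc: "path_ext n f' (Suc m) \<pi> \<in> paths (Suc m) Y" if "\<pi> \<in> paths (Suc (m + n)) X" for \<pi>
    using ext[of \<pi> "Suc m"] that by simp
  \<comment> \<open>Sources and targets are segments at offsets 0 and 1, and
    \<open>segment_path_ext\<close> moves both through \<open>path_ext\<close>.\<close>
  have "?h \<in> gph_hom (arc_gph (m + n) X) Z"
    by (rule gph_homI)
      (use gph_homD[OF g'] in \<open>auto simp: ext ext_Suc segment_path_ext segment_in_paths\<close>)
  moreover have "ho_comp X g f = ho_gamma (m + n) X ?h"
  proof -
    have "fst g (walk_ext f \<omega>) = fst g' (path_ext n f' m (segment 0 (m + n) \<omega>))"
      "snd g (walk_ext f \<omega>) = snd g' (path_ext n f' (Suc m) (segment 0 (Suc (m + n)) \<omega>))"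
      if "\<omega> \<in> walks X" for \<omega>
      using walk_ext_in_walks[OF f that] segment_walk_ext_ho_gamma[OF that, of _ n f', folded f_eq]
      by (auto simp: g_eq ho_gamma_eq)
    then show ?thesis
      by (auto simp: ho_comp_eq ho_gamma_eq[of "m + n"] segment_walk_in_paths restrict_def fun_eq_iff)
  qed
  ultimately show ?thesis
    using ho_comp_in_Ho[OF f g] unfolding of_level_def by blast
qed

lemma ho_comp_finite_level:
  "f \<in> finite_level X Y \<Longrightarrow> g \<in> finite_level Y Z \<Longrightarrow> ho_comp X g f \<in> finite_level X Z"
  using of_level_ho_comp unfolding finite_level_def by blast

lemma category_HoGph: "category HoGph"
  by unfold_locales
    (auto simp: HoGph_def s0_in_Ho ho_comp_s0_right ho_comp_s0_left ho_comp_assoc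
      intro: ho_comp_in_Ho)

text \<open>The objects of \<open>HoGph\<close> share one node type and one arc type; the second
  conjunct covers composition across graphs of unrelated types.\<close>

theorem mainTheorem3:
  shows "subcategory (HoGph :: (('a, 'b) pre_digraph, ('a, 'b, 'a, 'b) ho_arrow) precategory)
           (Obj HoGph) finite_level
    \<and> (\<forall>(X :: ('v, 'e) pre_digraph) (Y :: ('w, 'd) pre_digraph) (Z :: ('u, 'c) pre_digraph) f g.
         wf_digraph X \<longrightarrow> wf_digraph Y \<longrightarrow> wf_digraph Z \<longrightarrow>
         f \<in> finite_level X Y \<longrightarrow> g \<in> finite_level Y Z \<longrightarrow> ho_comp X g f \<in> finite_level X Z)"
proof
  have "finite_level X Y \<subseteq> Ho X Y" for X Y :: "('a, 'b) pre_digraph"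
    by (auto simp: finite_level_def of_level_def)
  then show "subcategory (HoGph :: (('a, 'b) pre_digraph, ('a, 'b, 'a, 'b) ho_arrow) precategory)
      (Obj HoGph) finite_level"
    by (intro subcategory.intro category_HoGph subcategory_axioms.intro)
      (simp_all add: HoGph_def s0_finite_level ho_comp_finite_level)
qed (use ho_comp_finite_level in blast)

end
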